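(* For every $n\ge 1$, the cyclic anti-phase profile $C_n$ satisfies $\operatorname{Stab}(C_n)=\{\mu_0,\dots,\mu_{n-1}\}$, where $\mu_k$ is the shift matching $\mu_k(m_i)=w_{i+k}$ (indices modulo $n$); in particular $|\operatorname{Stab}(C_n)|=n$.
   Context: There are men $m_0,\dots,m_{n-1}$ and women $w_0,\dots,w_{n-1}$, each with a strict total preference order over all participants of the opposite side; a matching is a bijection $\mu$ from men to women. A pair $(m,w)$ blocks $\mu$ if $m$ prefers $w$ to $\mu(m)$ and $w$ prefers $m$ to $\mu^{-1}(w)$; $\mu$ is stable if no pair blocks it; $\operatorname{Stab}(S)$ is the set of stable matchings of a profile $S$. The cyclic anti-phase profile $C_n$ has, with indices modulo $n$, $$m_i:\ w_i\succ w_{i+1}\succ\cdots\succ w_{i-1},\qquad w_j:\ m_{j+1}\succ m_{j+2}\succ\cdots\succ m_j.$$ *)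

theory Defs
  imports Main "HOL-Library.FuncSet"
begin

text \<open>Both men and women are represented by their indices \<open>0, ..., n - 1\<close>.\<close>

type_synonym man = nat
type_synonym woman = nat

text \<open>Preferences are strict: \<open>(x, y) \<in> men_pref S m\<close> means that \<open>m\<close> prefers \<open>x\<close> to \<open>y\<close>.\<close>

record profile =
  men_pref :: "man \<Rightarrow> woman rel"
  women_pref :: "woman \<Rightarrow> man rel"

definition pref_order :: "nat \<Rightarrow> nat rel \<Rightarrow> bool" where
  "pref_order n r \<longleftrightarrow> r \<subseteq> {..<n} \<times> {..<n} \<and> strict_linear_order_on {..<n} r"

definition is_profile :: "nat \<Rightarrow> profile \<Rightarrow> bool" where
  "is_profile n S \<longleftrightarrow>
     (\<forall>m<n. pref_order n (men_pref S m)) \<and> (\<forall>w<n. pref_order n (women_pref S w))"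

text \<open>Matchings are required to be extensional (\<open>undefined\<close> outside \<open>{..<n}\<close>), so that equality of
  matchings and the number of matchings depend only on the values on the \<open>n\<close> men.\<close>

definition is_matching :: "nat \<Rightarrow> (man \<Rightarrow> woman) \<Rightarrow> bool" where
  "is_matching n \<mu> \<longleftrightarrow> \<mu> \<in> extensional {..<n} \<and> bij_betw \<mu> {..<n} {..<n}"

definition blocks :: "nat \<Rightarrow> profile \<Rightarrow> (man \<Rightarrow> woman) \<Rightarrow> man \<Rightarrow> woman \<Rightarrow> bool" where
  "blocks n S \<mu> m w \<longleftrightarrow>
     (w, \<mu> m) \<in> men_pref S m \<and> (m, inv_into {..<n} \<mu> w) \<in> women_pref S w"

definition stable :: "nat \<Rightarrow> profile \<Rightarrow> (man \<Rightarrow> woman) \<Rightarrow> bool" where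
  "stable n S \<mu> \<longleftrightarrow> \<not> (\<exists>m<n. \<exists>w<n. blocks n S \<mu> m w)"

definition Stab :: "nat \<Rightarrow> profile \<Rightarrow> (man \<Rightarrow> woman) set" where
  "Stab n S = {\<mu>. is_matching n \<mu> \<and> stable n S \<mu>}"

text \<open>The strict order given by a preference list, most preferred first.\<close>

definition list_order :: "nat list \<Rightarrow> nat rel" where
  "list_order xs = {(xs ! a, xs ! b) | a b. a < b \<and> b < length xs}"

definition cyclic_profile :: "nat \<Rightarrow> profile" where
  "cyclic_profile n =
     \<lparr> men_pref = (\<lambda>i. list_order (map (\<lambda>t. (i + t) mod n) [0..<n])),
       women_pref = (\<lambda>j. list_order (map (\<lambda>t. (j + 1 + t) mod n) [0..<n])) \<rparr>"

definition shift_matching :: "nat \<Rightarrow> nat \<Rightarrow> man \<Rightarrow> woman" where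
  "shift_matching n k = (\<lambda>i\<in>{..<n}. (i + k) mod n)"

lemma pref_order_list_order:
  assumes "distinct xs" and "set xs = {..<n}"
  shows "pref_order n (list_order xs)"
proof -
  have "list_order xs \<subseteq> {..<n} \<times> {..<n}"
    using assms(2) nth_mem by (fastforce simp: list_order_def)
  moreover have "trans (list_order xs)"
  proof (rule transI)
    fix x y z assume "(x, y) \<in> list_order xs" "(y, z) \<in> list_order xs"
    then obtain a b c d where *: "x = xs ! a" "y = xs ! b" "a < b" "b < length xs"
      "y = xs ! c" "z = xs ! d" "c < d" "d < length xs"
      by (auto simp: list_order_def)
    with assms(1) have "b = c"
      by (metis nth_eq_iff_index_eq order.strict_trans)
    with * have "x = xs ! a \<and> z = xs ! d \<and> a < d \<and> d < length xs"
      by simp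
    then show "(x, z) \<in> list_order xs"
      unfolding list_order_def by blast
  qed
  moreover have "irrefl (list_order xs)"
    using assms(1) by (auto simp: irrefl_def list_order_def nth_eq_iff_index_eq)
  moreover have "total_on {..<n} (list_order xs)"
  proof (rule total_onI)
    fix x y assume "x \<in> {..<n}" "y \<in> {..<n}" "x \<noteq> y"
    then obtain a b where "x = xs ! a" "y = xs ! b" "a < length xs" "b < length xs" "a \<noteq> b"
      using assms(2) by (metis in_set_conv_nth)
    then show "(x, y) \<in> list_order xs \<or> (y, x) \<in> list_order xs"
      by (auto simp: list_order_def linorder_neq_iff)
  qed
  ultimately show ?thesis
    by (simp add: pref_order_def strict_linear_order_on_def)
qed

lemma pref_order_rotation:
  "pref_order n (list_order (map (\<lambda>t. (c + t) mod n) [0..<n]))"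
proof (rule pref_order_list_order)
  have inj: "inj_on (\<lambda>t. (c + t) mod n) {..<n}"
  proof (rule linorder_inj_onI')
    fix s t assume *: "s \<in> {..<n}" "t \<in> {..<n}" "s < t"
    show "(c + s) mod n \<noteq> (c + t) mod n"
    proof
      assume "(c + s) mod n = (c + t) mod n"
      then have "n dvd (c + t) - (c + s)"
        using *(3) by (metis mod_eq_dvd_iff_nat nat_add_left_cancel_le less_imp_le)
      with * show False
        by (auto dest: dvd_imp_le)
    qed
  qed
  then show "distinct (map (\<lambda>t. (c + t) mod n) [0..<n])"
    by (simp add: distinct_map atLeast0LessThan)
  have "(\<lambda>t. (c + t) mod n) ` {..<n} \<subseteq> {..<n}"
    by auto
  with inj show "set (map (\<lambda>t. (c + t) mod n) [0..<n]) = {..<n}"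
    by (simp add: atLeast0LessThan endo_inj_surj)
qed

lemma is_profile_cyclic_profile: "is_profile n (cyclic_profile n)"
  using pref_order_rotation by (simp add: is_profile_def cyclic_profile_def del: add_Suc)

end

theory Submission
  imports Defs "HOL-Number_Theory.Cong"
begin

text \<open>
  Let \<open>d m \<in> {0, ..., n - 1}\<close> be the residue of \<open>w - m\<close>, where \<open>w\<close> is the partner of \<open>m\<close>.
  Men prefer small residues and women large ones, so a pair \<open>(m, w)\<close> with residue \<open>a\<close> blocks iff
  \<open>d m' < a < d m\<close>, where \<open>m'\<close> is the partner of \<open>w\<close>. Hence constant \<open>d\<close>, i.e. a shift, is stable.
  Conversely, pair \<open>m\<close> with the partner of \<open>m + 1\<close>: the residue is \<open>d (m + 1) + 1\<close>, so stability
  excludes \<open>d m > d (m + 1) + 1\<close>, and injectivity excludes \<open>d m = d (m + 1) + 1\<close>. Thus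
  \<open>d m \<le> d (m + 1)\<close> all the way around the cycle, and \<open>d\<close> is constant.
\<close>

lemma add_mod_cancel_left_nat:
  fixes a b c n :: nat
  assumes "a < n" "b < n"
  shows "(c + a) mod n = (c + b) mod n \<longleftrightarrow> a = b"
  using assms by (metis cong_add_lcancel_nat cong_def mod_less)

lemma ex_residue:
  fixes m w n :: nat
  assumes "m < n" "w < n"
  obtains a where "a < n" "(m + a) mod n = w"
proof
  \<comment> \<open>The witness is w - m with n added first, so that natural-number subtraction does
    not truncate when w < m.\<close>
  show "(n - m + w) mod n < n" "(m + (n - m + w) mod n) mod n = w"
    using assms by (simp_all add: mod_add_right_eq)
qed

lemma rotation_list_order_iff:
  assumes "a < n" "b < n"
  shows "((c + a) mod n, (c + b) mod n) \<in> list_order (map (\<lambda>t. (c + t) mod n) [0..<n]) \<longleftrightarrow> a < b"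
proof
  assume "a < b"
  then show "((c + a) mod n, (c + b) mod n) \<in> list_order (map (\<lambda>t. (c + t) mod n) [0..<n])"
    unfolding list_order_def using assms by (intro CollectI exI[of _ a] exI[of _ b]) simp
qed (use assms in \<open>auto simp: list_order_def add_mod_cancel_left_nat\<close>)

text \<open>The list of woman m + a starts at m + a + 1; another n - 1 - a steps reach m + n, which
  is m. So she ranks a man at residue a in position n - 1 - a, and larger residues come
  first.\<close>

lemma rank_by_woman:
  fixes m a n :: nat
  assumes "m < n" "a < n"
  shows "((m + a) mod n + 1 + (n - 1 - a)) mod n = m"
proof -
  have "((m + a) mod n + 1 + (n - 1 - a)) mod n = (m + a + (1 + (n - 1 - a))) mod n"
    by (simp only: mod_add_left_eq add.assoc)
  also have "m + a + (1 + (n - 1 - a)) = m + n"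
    using assms by simp
  finally show ?thesis
    using assms by simp
qed

text \<open>Here b and c are the residues of the couples of m and m'. The man compares positions a
  and b in his list; the woman compares n - 1 - a and n - 1 - c, which reverses the order of a and
  c.\<close>

lemma blocks_cyclic_profile_iff:
  assumes \<mu>: "inj_on \<mu> {..<n}"
    and m: "m < n" "a < n" "b < n" "\<mu> m = (m + b) mod n"
    and m': "m' < n" "c < n" "\<mu> m' = (m' + c) mod n" "\<mu> m' = (m + a) mod n"
  shows "blocks n (cyclic_profile n) \<mu> m ((m + a) mod n) \<longleftrightarrow> c < a \<and> a < b"
proof -
  define w where "w = (m + a) mod n"
  have inv: "inv_into {..<n} \<mu> w = m'"
    unfolding w_def using \<mu> m' by (metis inv_into_f_f lessThan_iff)
  have "m = (w + 1 + (n - 1 - a)) mod n"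
    unfolding w_def using rank_by_woman m by simp
  moreover have "m' = (w + 1 + (n - 1 - c)) mod n"
    using rank_by_woman[of m' n c] m' unfolding w_def by argo
  ultimately have "(m, m') \<in> women_pref (cyclic_profile n) w \<longleftrightarrow> n - 1 - a < n - 1 - c"
    using rotation_list_order_iff[of "n - 1 - a" n "n - 1 - c" "w + 1"] m(2)
    by (simp add: cyclic_profile_def)
  moreover have "(w, \<mu> m) \<in> men_pref (cyclic_profile n) m \<longleftrightarrow> a < b"
    using m by (simp add: w_def cyclic_profile_def rotation_list_order_iff)
  ultimately show ?thesis
    unfolding blocks_def w_def[symmetric] inv using m m' by auto
qed

lemma is_matching_shift_matching: "is_matching n (shift_matching n k)"
proof -
  have inj: "inj_on (shift_matching n k) {..<n}"
    by (auto simp: inj_on_def shift_matching_def add_mod_cancel_left_nat add.commute[of _ k])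
  moreover have "shift_matching n k ` {..<n} \<subseteq> {..<n}"
    by (auto simp: shift_matching_def)
  ultimately show ?thesis
    by (simp add: is_matching_def bij_betw_def endo_inj_surj) (simp add: shift_matching_def)
qed

lemma stable_shift_matching:
  assumes "k < n"
  shows "stable n (cyclic_profile n) (shift_matching n k)"
  unfolding stable_def
proof clarify
  fix m w
  let ?\<mu> = "shift_matching n k"
  assume "m < n" "w < n" and blocks: "blocks n (cyclic_profile n) ?\<mu> m w"
  then obtain a where a: "a < n" "w = (m + a) mod n"
    using ex_residue by metis
  have bij: "bij_betw ?\<mu> {..<n} {..<n}"
    using is_matching_shift_matching by (simp add: is_matching_def)
  then obtain m' where m': "m' < n" "?\<mu> m' = w"
    using \<open>w < n\<close> by (metis bij_betw_iff_bijections lessThan_iff)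
  \<comment> \<open>Both couples broken up by the blocking pair have residue k, so k plays the roles
    of b and c at once.\<close>
  have "k < a \<and> a < k"
    using blocks_cyclic_profile_iff[OF bij_betw_imp_inj_on[OF bij] \<open>m < n\<close> a(1) assms _ m'(1) assms]
      blocks a m' \<open>m < n\<close> by (simp add: shift_matching_def)
  then show False
    by auto
qed

lemma stable_imp_shift_matching:
  assumes "n \<ge> 1" and matching: "is_matching n \<mu>" and stable: "stable n (cyclic_profile n) \<mu>"
  shows "\<exists>k<n. \<mu> = shift_matching n k"
proof -
  have inj: "inj_on \<mu> {..<n}"
    using matching by (simp add: is_matching_def bij_betw_def)
  have \<mu>_less: "\<mu> m < n" if "m < n" for m
    using matching that by (auto simp: is_matching_def bij_betw_def)
  have "\<exists>a<n. \<mu> m = (m + a) mod n" if "m < n" for m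
    using ex_residue[OF that \<mu>_less[OF that]] by metis
  then obtain d where d: "d m < n" "\<mu> m = (m + d m) mod n" if "m < n" for m
    by metis
  have step: "d m \<le> d (Suc m mod n)" if m: "m < n" for m
  proof (rule ccontr)
    assume "\<not> d m \<le> d (Suc m mod n)"
    moreover define m' where "m' = Suc m mod n"
    ultimately have less: "d m' < d m"
      by simp
    have m': "m' < n"
      using m by (simp add: m'_def)
    have \<mu>m': "\<mu> m' = (m + Suc (d m')) mod n"
      using d(2)[OF m'] by (simp add: m'_def mod_add_left_eq)
    \<comment> \<open>The residue of m with the partner of m' does not wrap around to 0.\<close>
    have a: "Suc (d m') < n"
      using less d(1)[OF m] by simp
    show False
    proof (cases "d m = Suc (d m')")
      case True
      then have "\<mu> m = \<mu> m'"
        using d(2)[OF m] \<mu>m' by simp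
      then have "m = m'"
        using inj m m' by (auto dest: inj_onD)
      with less show False
        by simp
    next
      case False
      with less have "blocks n (cyclic_profile n) \<mu> m ((m + Suc (d m')) mod n)"
        using blocks_cyclic_profile_iff[OF inj m a d[OF m] m' d[OF m'] \<mu>m'] m by simp
      moreover have "(m + Suc (d m')) mod n < n"
        using m by simp
      ultimately show False
        using stable m unfolding stable_def by blast
    qed
  qed
  have mono: "d i \<le> d j" if "i \<le> j" "j < n" for i j
    using that
  proof (induction j rule: dec_induct)
    case (step j)
    then show ?case
      using \<open>\<And>m. m < n \<Longrightarrow> d m \<le> d (Suc m mod n)\<close>[of j] by simp
  qed simp
  have "d m = d 0" if "m < n" for m
  proof (rule antisym)
    \<comment> \<open>The successor of n - 1 modulo n is 0, which closes the chain of
      inequalities.\<close>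
    have "d m \<le> d (n - 1)"
      using mono that by simp
    also have "\<dots> \<le> d 0"
      using step[of "n - 1"] \<open>n \<ge> 1\<close> by simp
    finally show "d m \<le> d 0" .
  qed (use mono that in simp)
  then have "\<mu> m = (m + d 0) mod n" if "m < n" for m
    using d(2) that by metis
  then have "\<mu> = shift_matching n (d 0)"
    using matching
    by (intro extensionalityI[of _ "{..<n}"]) (auto simp: is_matching_def shift_matching_def)
  then show ?thesis
    using d(1)[of 0] \<open>n \<ge> 1\<close> by auto
qed

theorem proposition3p3:
  fixes n :: nat
  assumes "n \<ge> 1"
  shows "Stab n (cyclic_profile n) = {shift_matching n k | k. k < n} \<and>
         card (Stab n (cyclic_profile n)) = n"
proof
  show eq: "Stab n (cyclic_profile n) = {shift_matching n k | k. k < n}"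
    using stable_imp_shift_matching[OF assms] is_matching_shift_matching stable_shift_matching
    by (auto simp: Stab_def)
  have "inj_on (shift_matching n) {..<n}"
  proof (rule inj_onI)
    fix k l assume "k \<in> {..<n}" "l \<in> {..<n}" "shift_matching n k = shift_matching n l"
    \<comment> \<open>The partner of man 0 reveals the shift.\<close>
    moreover have "shift_matching n j 0 = j" if "j < n" for j
      using that by (simp add: shift_matching_def)
    ultimately show "k = l"
      by (metis lessThan_iff)
  qed
  moreover have "{shift_matching n k | k. k < n} = shift_matching n ` {..<n}"
    by auto
  ultimately show "card (Stab n (cyclic_profile n)) = n"
    by (simp add: eq card_image)
qed

end
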